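(* For $n=3$, $K_3=3/2$ almost surely; $S_3=\cos(3\theta)/\sqrt2$ with $\theta$ uniform on $[0,2\pi)$; and $\mathrm{JB}_3=9/32+Y/4$ with $Y\sim\mathrm{Beta}(\frac12,\frac12)$. Hence $\mathrm{JB}_3$ has support $[9/32,17/32]$ and, on it, distribution function $F(x)=(2/\pi)\arcsin\bigl(\{4(x-9/32)\}^{1/2}\bigr)$, density $4\pi^{-1}\{(4x-\frac98)(\frac{17}8-4x)\}^{-1/2}$, and $p$-quantile $9/32+\frac14\sin^2(\pi p/2)$.
   Context: $X_1,X_2,X_3$ are independent $N(\mu,\sigma^2)$ with $\sigma>0$; $m_r=\frac13\sum_{i=1}^3(X_i-\bar X)^r$, $S_3=m_3/m_2^{3/2}$, $K_3=m_4/m_2^2$, and $\mathrm{JB}_3=\frac12\{S_3^2+\frac14(K_3-3)^2\}$. Equivalently $(S_3,K_3)=(\sqrt3\sum_iU_i^3,\;3\sum_iU_i^4)$ with $U$ uniformly distributed on $\{u\in\mathbb{R}^3:\sum_iu_i=0,\ \sum_iu_i^2=1\}$. *)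

theory Defs
  imports "HOL-Probability.Probability"
begin

definition sample_mean :: "nat \<Rightarrow> (nat \<Rightarrow> real) \<Rightarrow> real" where
  "sample_mean n x = (\<Sum>i=1..n. x i) / real n"

definition central_moment :: "nat \<Rightarrow> nat \<Rightarrow> (nat \<Rightarrow> real) \<Rightarrow> real" where
  "central_moment n r x = (\<Sum>i=1..n. (x i - sample_mean n x) ^ r) / real n"

(* If all observations coincide, the second central moment vanishes, and both quotients
   below take the HOL value 0. *)

definition sample_skewness :: "nat \<Rightarrow> (nat \<Rightarrow> real) \<Rightarrow> real" where
  "sample_skewness n x = central_moment n 3 x / central_moment n 2 x powr (3 / 2)"

definition sample_kurtosis :: "nat \<Rightarrow> (nat \<Rightarrow> real) \<Rightarrow> real" where
  "sample_kurtosis n x = central_moment n 4 x / (central_moment n 2 x)\<^sup>2"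

(* The leading factor n / 6 is 1 / 2 for n = 3. *)
definition jarque_bera :: "nat \<Rightarrow> (nat \<Rightarrow> real) \<Rightarrow> real" where
  "jarque_bera n x =
     real n / 6 * ((sample_skewness n x)\<^sup>2 + (sample_kurtosis n x - 3)\<^sup>2 / 4)"

definition beta_density :: "real \<Rightarrow> real \<Rightarrow> real \<Rightarrow> real" where
  "beta_density a b y =
     (if 0 < y \<and> y < 1 then y powr (a - 1) * (1 - y) powr (b - 1) / Beta a b else 0)"

definition measure_support :: "real measure \<Rightarrow> real set" where
  "measure_support N = {x. \<forall>U. open U \<and> x \<in> U \<longrightarrow> emeasure N U > 0}"

(* Intended for probability measures on the Borel sets and 0 < p < 1; then the set is
   nonempty and bounded below, and its infimum is attained. *)
definition quantile :: "real measure \<Rightarrow> real \<Rightarrow> real" where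
  "quantile N p = Inf {x. p \<le> cdf N x}"

end

theory Submission
  imports Defs
begin

text \<open>The centred sample lives in the plane orthogonal to \<open>(1, 1, 1)\<close>, and skewness and kurtosis are
invariant under scaling, so for three observations both are functions of a single angle.  In the
orthonormal coordinates \<open>p = (2 x\<^sub>3 - x\<^sub>1 - x\<^sub>2) / \<surd>6\<close> and \<open>q = (x\<^sub>2 - x\<^sub>1) / \<surd>2\<close> of that plane, put
\<open>r\<^sup>2 = p\<^sup>2 + q\<^sup>2\<close>.  The second, third and fourth central moments are \<open>r\<^sup>2 / 3\<close>,
\<open>(p\<^sup>3 - 3 p q\<^sup>2) / (3 \<surd>6)\<close> and \<open>r\<^sup>4 / 6\<close>
(\<open>central_moments_contrasts\<close>).  Hence the kurtosis is the constant \<open>3 / 2\<close>; and if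
\<open>p = r cos \<theta>\<close>, the cubic is \<open>r\<^sup>3 (4 cos\<^sup>3 \<theta> - 3 cos \<theta>) = r\<^sup>3 cos (3 \<theta>)\<close> by the triple-angle
formula, so that the skewness is \<open>cos (3 \<theta>) / \<surd>2\<close> and the Jarque--Bera statistic is
\<open>9 / 32 + cos\<^sup>2 (3 \<theta>) / 4\<close> (\<open>jarque_bera_3\<close>).

It remains to find the law of \<open>\<theta>\<close>.  The Gaussian product measure is invariant under rotations,
and two rotations in coordinate planes carry the standardised sample to \<open>p / \<sigma>\<close>, \<open>q / \<sigma>\<close> and a
multiple of the standardised sample mean; so \<open>p / \<sigma>\<close> and \<open>q / \<sigma>\<close> are independent standard normal variables
(\<open>contrasts_std_gauss\<close>).  The
probability of a planar sector is obtained by integrating over rays: for fixed slope the radial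
integral is elementary and leaves the Cauchy density, whose primitive is the arctangent
(\<open>std_gauss_sector\<close>).  Every sector therefore has probability proportional to its angle,
that is, \<open>\<theta>\<close> is uniform (\<open>plane_angle_uniform\<close>).

Finally, \<open>cos\<^sup>2 (3 \<theta>)\<close> has six equal periods on \<open>[0, 2 \<pi>)\<close>, and on one of them the set
\<open>cos\<^sup>2 \<le> y\<close> is an interval of length \<open>2 arcsin (\<surd>y)\<close> around \<open>\<pi> / 2\<close>.  The distribution function is
thus \<open>(2 / \<pi>) arcsin (\<surd>y)\<close>; differentiating it gives the Beta density with both parameters
\<open>1 / 2\<close> (\<open>cos_squared_3_arcsine_law\<close>), and the support, the distribution function and the
quantiles are read off from it.\<close>

section \<open>Rotation invariance of the planar Gaussian measure\<close>

text \<open>Two one-dimensional affine substitutions are enough: for fixed \<open>y\<close> the first rotated coordinate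
replaces \<open>x\<close> at the cost of the factor \<open>1 / \<bar>c\<bar>\<close>, and for a fixed value of it the second one
replaces \<open>y\<close> at the cost of \<open>\<bar>c\<bar>\<close>.\<close>

lemma nn_integral_lborel_rotation:
  fixes f :: "real \<Rightarrow> real \<Rightarrow> ennreal"
  assumes f[measurable]: "case_prod f \<in> borel_measurable borel"
    and cs: "c\<^sup>2 + s\<^sup>2 = 1" and c: "c \<noteq> 0"
  shows "(\<integral>\<^sup>+x. \<integral>\<^sup>+y. f (c * x + s * y) (c * y - s * x) \<partial>lborel \<partial>lborel)
    = (\<integral>\<^sup>+x. \<integral>\<^sup>+y. f x y \<partial>lborel \<partial>lborel)"
proof -
  have f'[measurable]: "case_prod f \<in> borel_measurable (borel \<Otimes>\<^sub>M borel)"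
    using f by (simp add: borel_prod)
  have "(\<integral>\<^sup>+x. \<integral>\<^sup>+y. f (c * x + s * y) (c * y - s * x) \<partial>lborel \<partial>lborel)
      = (\<integral>\<^sup>+y. \<integral>\<^sup>+x. f (c * x + s * y) (c * y - s * x) \<partial>lborel \<partial>lborel)"
    by (rule lborel_pair.Fubini') measurable
  also have "\<dots> = (\<integral>\<^sup>+y. \<bar>1 / c\<bar> * (\<integral>\<^sup>+u. f u ((y - s * u) / c) \<partial>lborel) \<partial>lborel)"
  proof (rule nn_integral_cong)
    fix y
    have e: "c * (- s * y / c + 1 / c * u) + s * y = u"
      "c * y - s * (- s * y / c + 1 / c * u) = (y - s * u) / c" for u
    proof -
      show "c * (- s * y / c + 1 / c * u) + s * y = u" using c by (simp add: field_simps)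
      have "c * (c * y - s * (- s * y / c + 1 / c * u)) = (c\<^sup>2 + s\<^sup>2) * y - s * u"
        using c by (simp add: field_simps power2_eq_square)
      then have "c * (c * y - s * (- s * y / c + 1 / c * u)) = y - s * u"
        using cs by simp
      then show "c * y - s * (- s * y / c + 1 / c * u) = (y - s * u) / c"
        using c by (metis nonzero_mult_div_cancel_left)
    qed
    show "(\<integral>\<^sup>+x. f (c * x + s * y) (c * y - s * x) \<partial>lborel)
        = \<bar>1 / c\<bar> * (\<integral>\<^sup>+u. f u ((y - s * u) / c) \<partial>lborel)"
      by (subst nn_integral_real_affine[where c = "1 / c" and t = "- s * y / c"])
        (use c in \<open>measurable, simp_all only: e, simp\<close>)
  qed
  also have "\<dots> = \<bar>1 / c\<bar> * (\<integral>\<^sup>+y. \<integral>\<^sup>+u. f u ((y - s * u) / c) \<partial>lborel \<partial>lborel)"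
    by (rule nn_integral_cmult) measurable
  also have "\<dots> = \<bar>1 / c\<bar> * (\<integral>\<^sup>+u. \<integral>\<^sup>+y. f u ((y - s * u) / c) \<partial>lborel \<partial>lborel)"
    by (intro arg_cong2[where f = times] refl lborel_pair.Fubini') measurable
  also have "\<dots> = \<bar>1 / c\<bar> * (\<integral>\<^sup>+u. \<bar>c\<bar> * (\<integral>\<^sup>+v. f u v \<partial>lborel) \<partial>lborel)"
  proof (intro arg_cong2[where f = times] nn_integral_cong refl)
    fix u
    show "(\<integral>\<^sup>+y. f u ((y - s * u) / c) \<partial>lborel) = \<bar>c\<bar> * (\<integral>\<^sup>+v. f u v \<partial>lborel)"
      by (subst nn_integral_real_affine[where c = c and t = "s * u"])
        (use c in \<open>measurable, simp_all\<close>)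
  qed
  also have "\<dots> = (\<bar>1 / c\<bar> * ennreal \<bar>c\<bar>) * (\<integral>\<^sup>+u. \<integral>\<^sup>+v. f u v \<partial>lborel \<partial>lborel)"
    by (subst nn_integral_cmult) (measurable, simp add: mult.assoc)
  also have "\<bar>1 / c\<bar> * ennreal \<bar>c\<bar> = 1"
    using c by (simp flip: ennreal_mult)
  finally show ?thesis by simp
qed

abbreviation std_gauss :: "real measure" where
  "std_gauss \<equiv> density lborel (\<lambda>x. ennreal (std_normal_density x))"

lemma prob_space_std_gauss: "prob_space std_gauss"
  by (rule prob_space_normal_density) simp

lemma std_normal_density_rotation:
  assumes "c\<^sup>2 + s\<^sup>2 = 1"
  shows "std_normal_density (c * x + s * y) * std_normal_density (c * y - s * x)
    = std_normal_density x * std_normal_density y"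
proof -
  have "(c * x + s * y)\<^sup>2 + (c * y - s * x)\<^sup>2 = (c\<^sup>2 + s\<^sup>2) * (x\<^sup>2 + y\<^sup>2)"
    by (simp add: power2_eq_square algebra_simps)
  then have e: "(c * x + s * y)\<^sup>2 + (c * y - s * x)\<^sup>2 = x\<^sup>2 + y\<^sup>2" using assms by simp
  have "exp (- (c * x + s * y)\<^sup>2 / 2) * exp (- (c * y - s * x)\<^sup>2 / 2)
      = exp (- ((c * x + s * y)\<^sup>2 + (c * y - s * x)\<^sup>2) / 2)"
    by (simp add: exp_add[symmetric] field_simps)
  also have "\<dots> = exp (- x\<^sup>2 / 2) * exp (- y\<^sup>2 / 2)"
    unfolding e by (simp add: exp_add[symmetric] field_simps)
  finally show ?thesis
    by (simp add: std_normal_density_def)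
qed

lemma nn_integral_std_gauss2:
  assumes f[measurable]: "case_prod f \<in> borel_measurable (borel \<Otimes>\<^sub>M borel)"
  shows "(\<integral>\<^sup>+x. \<integral>\<^sup>+y. f x y \<partial>std_gauss \<partial>std_gauss)
    = (\<integral>\<^sup>+x. \<integral>\<^sup>+y. ennreal (std_normal_density x * std_normal_density y) * f x y \<partial>lborel \<partial>lborel)"
  by (subst nn_integral_density, measurable)+
    (auto simp: nn_integral_cmult[symmetric] nn_integral_density ennreal_mult' mult.assoc
       intro!: nn_integral_cong)

lemma nn_integral_std_gauss_rotation:
  fixes f :: "real \<Rightarrow> real \<Rightarrow> ennreal"
  assumes f[measurable]: "case_prod f \<in> borel_measurable borel"
    and cs: "c\<^sup>2 + s\<^sup>2 = 1" and c: "c \<noteq> 0"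
  shows "(\<integral>\<^sup>+x. \<integral>\<^sup>+y. f (c * x + s * y) (c * y - s * x) \<partial>std_gauss \<partial>std_gauss)
    = (\<integral>\<^sup>+x. \<integral>\<^sup>+y. f x y \<partial>std_gauss \<partial>std_gauss)"
proof -
  have f'[measurable]: "case_prod f \<in> borel_measurable (borel \<Otimes>\<^sub>M borel)"
    using f by (simp add: borel_prod)
  have "(\<lambda>(x, y). ennreal (std_normal_density x * std_normal_density y) * f x y)
      \<in> borel_measurable (borel \<Otimes>\<^sub>M borel)"
    by measurable
  then have m: "(\<lambda>(x, y). ennreal (std_normal_density x * std_normal_density y) * f x y)
      \<in> borel_measurable borel" by (simp add: borel_prod)
  show ?thesis
    using nn_integral_lborel_rotation[OF m cs c]
    by (subst (1 2) nn_integral_std_gauss2, measurable) (simp add: std_normal_density_rotation[OF cs])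
qed

lemma nn_integral_std_gauss_minus:
  assumes [measurable]: "f \<in> borel_measurable borel"
  shows "(\<integral>\<^sup>+x. f (- x) \<partial>std_gauss) = (\<integral>\<^sup>+x. f x \<partial>std_gauss)"
  by (subst (1 2) nn_integral_density, measurable,
      subst (2) nn_integral_real_affine[where c = "-1" and t = 0])
    (simp_all add: std_normal_density_def)

section \<open>The two contrasts of three normal observations\<close>

text \<open>Together with the normalised sum \<open>(x\<^sub>1 + x\<^sub>2 + x\<^sub>3) / \<surd>3\<close>, the next two linear forms are orthonormal
coordinates of three-dimensional space.\<close>

definition contrast_p :: "(nat \<Rightarrow> real) \<Rightarrow> real" where
  "contrast_p x = (2 * x 3 - x 1 - x 2) / sqrt 6"

definition contrast_q :: "(nat \<Rightarrow> real) \<Rightarrow> real" where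
  "contrast_q x = (x 2 - x 1) / sqrt 2"

text \<open>A rotation by \<open>\<pi> / 4\<close> in the \<open>(x, y)\<close> plane produces the second contrast and \<open>u = (x + y) / \<surd>2\<close>; a
rotation in the \<open>(z, u)\<close> plane then produces the first contrast and the normalised sum, over which
the probability measure integrates out.\<close>

lemma nn_integral_std_gauss_contrasts:
  fixes g :: "real \<Rightarrow> real \<Rightarrow> ennreal"
  assumes g[measurable]: "case_prod g \<in> borel_measurable (borel \<Otimes>\<^sub>M borel)"
  shows "(\<integral>\<^sup>+z. \<integral>\<^sup>+x. \<integral>\<^sup>+y. g ((2 * z - x - y) / sqrt 6) ((y - x) / sqrt 2) \<partial>std_gauss \<partial>std_gauss \<partial>std_gauss)
    = (\<integral>\<^sup>+p. \<integral>\<^sup>+q. g p q \<partial>std_gauss \<partial>std_gauss)"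
proof -
  interpret G: prob_space std_gauss by (rule prob_space_std_gauss)
  have r6: "sqrt 6 = sqrt 2 * sqrt 3" by (simp flip: real_sqrt_mult)
  have "(\<integral>\<^sup>+z. \<integral>\<^sup>+x. \<integral>\<^sup>+y. g ((2 * z - x - y) / sqrt 6) ((y - x) / sqrt 2) \<partial>std_gauss \<partial>std_gauss \<partial>std_gauss)
    = (\<integral>\<^sup>+z. \<integral>\<^sup>+u. \<integral>\<^sup>+q. g (sqrt (2/3) * z + (-1 / sqrt 3) * u) q \<partial>std_gauss \<partial>std_gauss \<partial>std_gauss)"
  proof (rule nn_integral_cong)
    fix z :: real
    let ?f = "\<lambda>u q. g (sqrt (2/3) * z + (-1 / sqrt 3) * u) q"
    have "case_prod ?f \<in> borel_measurable (borel \<Otimes>\<^sub>M borel)" by measurable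
    then have m: "case_prod ?f \<in> borel_measurable borel" by (simp add: borel_prod)
    have e: "sqrt (2/3) * z + (-1 / sqrt 3) * (1 / sqrt 2 * x + 1 / sqrt 2 * y) = (2 * z - x - y) / sqrt 6"
      "1 / sqrt 2 * y - 1 / sqrt 2 * x = (y - x) / sqrt 2" for x y
      by (simp_all add: r6 real_sqrt_divide field_simps)
    show "(\<integral>\<^sup>+x. \<integral>\<^sup>+y. g ((2 * z - x - y) / sqrt 6) ((y - x) / sqrt 2) \<partial>std_gauss \<partial>std_gauss)
      = (\<integral>\<^sup>+u. \<integral>\<^sup>+q. ?f u q \<partial>std_gauss \<partial>std_gauss)"
      using nn_integral_std_gauss_rotation[OF m, of "1 / sqrt 2" "1 / sqrt 2"]
      by (simp only: e) (simp add: power_divide)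
  qed
  also have "\<dots> = (\<integral>\<^sup>+p. \<integral>\<^sup>+w. \<integral>\<^sup>+q. g p q \<partial>std_gauss \<partial>std_gauss \<partial>std_gauss)"
  proof -
    have "(\<lambda>(p, w :: real). \<integral>\<^sup>+q. g p q \<partial>std_gauss) \<in> borel_measurable (borel \<Otimes>\<^sub>M borel)"
      by measurable
    then have m: "(\<lambda>(p, w :: real). \<integral>\<^sup>+q. g p q \<partial>std_gauss) \<in> borel_measurable borel"
      by (simp only: borel_prod)
    show ?thesis
      using nn_integral_std_gauss_rotation[OF m, of "sqrt (2/3)" "-1 / sqrt 3"]
      by (simp add: power_divide)
  qed
  also have "\<dots> = (\<integral>\<^sup>+p. \<integral>\<^sup>+q. g p q \<partial>std_gauss \<partial>std_gauss)"
    by (simp add: G.emeasure_space_1[simplified])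
  finally show ?thesis .
qed

text \<open>The joint law of the three variables is the product measure; the third coordinate is integrated
outermost because the first of the two rotations acts on the other two with the third one fixed.\<close>

lemma (in prob_space) nn_integral_std_normal_triple:
  fixes Z :: "nat \<Rightarrow> 'a \<Rightarrow> real" and f :: "real \<Rightarrow> real \<Rightarrow> real \<Rightarrow> ennreal"
  assumes ind: "indep_vars (\<lambda>_. borel) Z {1..3}"
    and Z: "\<And>i. i \<in> {1..3} \<Longrightarrow> distributed M lborel (Z i) (\<lambda>x. ennreal (std_normal_density x))"
    and f[measurable]: "(\<lambda>(x, y, z). f x y z) \<in> borel_measurable (borel \<Otimes>\<^sub>M borel \<Otimes>\<^sub>M borel)"
  shows "(\<integral>\<^sup>+\<omega>. f (Z 1 \<omega>) (Z 2 \<omega>) (Z 3 \<omega>) \<partial>M)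
    = (\<integral>\<^sup>+z. \<integral>\<^sup>+x. \<integral>\<^sup>+y. f x y z \<partial>std_gauss \<partial>std_gauss \<partial>std_gauss)"
proof -
  interpret G: prob_space std_gauss by (rule prob_space_std_gauss)
  interpret product_sigma_finite "\<lambda>_::nat. std_gauss" ..
  have rv[measurable]: "Z i \<in> borel_measurable M" if "i \<in> {1..3}" for i
    using distributed_measurable[OF Z[OF that]] by simp
  have I: "{1..3} = {1, 2, 3::nat}" by auto
  have d: "distr M borel (Z i) = std_gauss" if "i \<in> {1..3}" for i
    using distributed_distr_eq_density[OF Z[OF that]] by (simp cong: distr_cong)
  have "distr M (\<Pi>\<^sub>M i\<in>{1..3}. borel) (\<lambda>\<omega>. \<lambda>i\<in>{1..3}. Z i \<omega>) = (\<Pi>\<^sub>M i\<in>{1..3}. distr M borel (Z i))"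
    by (rule indep_vars_iff_distr_eq_PiM'[THEN iffD1]) (use ind rv in auto)
  also have "\<dots> = (\<Pi>\<^sub>M i\<in>{1..3}. std_gauss)"
    by (intro PiM_cong refl d)
  finally have D: "distr M (\<Pi>\<^sub>M i\<in>{1..3}. borel) (\<lambda>\<omega>. \<lambda>i\<in>{1..3}. Z i \<omega>) = (\<Pi>\<^sub>M i\<in>{1, 2, 3::nat}. std_gauss)"
    unfolding I .
  have mZ: "(\<lambda>\<omega>. \<lambda>i\<in>{1..3}. Z i \<omega>) \<in> M \<rightarrow>\<^sub>M (\<Pi>\<^sub>M i\<in>{1..3}. borel)"
    by (intro measurable_restrict rv)
  have fm[measurable (raw)]: "(\<lambda>w. f (a w) (b w) (c w)) \<in> borel_measurable N"
    if "a \<in> borel_measurable N" "b \<in> borel_measurable N" "c \<in> borel_measurable N"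
    for a b c and N :: "'c measure"
    using measurable_compose[OF measurable_Pair[OF that(1) measurable_Pair[OF that(2,3)]] f]
    by simp
  have "(\<integral>\<^sup>+\<omega>. f (Z 1 \<omega>) (Z 2 \<omega>) (Z 3 \<omega>) \<partial>M)
      = (\<integral>\<^sup>+w. f (w 1) (w 2) (w 3) \<partial>distr M (\<Pi>\<^sub>M i\<in>{1..3}. borel) (\<lambda>\<omega>. \<lambda>i\<in>{1..3}. Z i \<omega>))"
    by (subst nn_integral_distr[OF mZ], measurable)
  also have "\<dots> = (\<integral>\<^sup>+w. f (w 1) (w 2) (w 3) \<partial>(\<Pi>\<^sub>M i\<in>{3, 1, 2::nat}. std_gauss))"
    unfolding D by (simp only: insert_commute)
  also have "\<dots> = (\<integral>\<^sup>+z. \<integral>\<^sup>+w. f (w 1) (w 2) z \<partial>(\<Pi>\<^sub>M i\<in>{1, 2::nat}. std_gauss) \<partial>std_gauss)"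
    by (subst product_nn_integral_insert_rev, simp, simp, measurable)
  also have "\<dots> = (\<integral>\<^sup>+z. \<integral>\<^sup>+x. \<integral>\<^sup>+w. f x (w 2) z \<partial>(\<Pi>\<^sub>M i\<in>{2::nat}. std_gauss) \<partial>std_gauss \<partial>std_gauss)"
    by (rule nn_integral_cong, subst product_nn_integral_insert_rev, simp, simp, measurable)
  also have "\<dots> = (\<integral>\<^sup>+z. \<integral>\<^sup>+x. \<integral>\<^sup>+y. f x y z \<partial>std_gauss \<partial>std_gauss \<partial>std_gauss)"
    by (intro nn_integral_cong, rule product_nn_integral_singleton, measurable)
  finally show ?thesis .
qed

lemma (in prob_space) contrasts_std_gauss:
  fixes X :: "nat \<Rightarrow> 'a \<Rightarrow> real"
  assumes \<sigma>: "\<sigma> > 0"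
    and ind: "indep_vars (\<lambda>_. borel) X {1..3}"
    and X: "\<And>i. i \<in> {1..3} \<Longrightarrow> distributed M lborel (X i) (\<lambda>x. ennreal (normal_density \<mu> \<sigma> x))"
    and g[measurable]: "case_prod g \<in> borel_measurable (borel \<Otimes>\<^sub>M borel)"
  shows "(\<integral>\<^sup>+\<omega>. g (contrast_p (\<lambda>i. X i \<omega>) / \<sigma>) (contrast_q (\<lambda>i. X i \<omega>) / \<sigma>) \<partial>M)
    = (\<integral>\<^sup>+p. \<integral>\<^sup>+q. g p q \<partial>std_gauss \<partial>std_gauss)"
proof -
  define Z where "Z = (\<lambda>i \<omega>. (X i \<omega> - \<mu>) / \<sigma>)"
  have Zi: "indep_vars (\<lambda>_. borel) Z {1..3}"
    unfolding Z_def by (rule indep_vars_compose2[OF ind]) measurable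
  have Zd: "distributed M lborel (Z i) (\<lambda>x. ennreal (std_normal_density x))" if "i \<in> {1..3}" for i
    unfolding Z_def by (rule normal_standard_normal_convert[OF \<sigma>, THEN iffD1, OF X[OF that]])
  have "2 * Z 3 \<omega> - Z 1 \<omega> - Z 2 \<omega> = (2 * X 3 \<omega> - X 1 \<omega> - X 2 \<omega>) / \<sigma>"
    "Z 2 \<omega> - Z 1 \<omega> = (X 2 \<omega> - X 1 \<omega>) / \<sigma>" for \<omega>
    by (simp_all add: Z_def diff_divide_distrib)
  then have "contrast_p (\<lambda>i. X i \<omega>) / \<sigma> = (2 * Z 3 \<omega> - Z 1 \<omega> - Z 2 \<omega>) / sqrt 6"
    "contrast_q (\<lambda>i. X i \<omega>) / \<sigma> = (Z 2 \<omega> - Z 1 \<omega>) / sqrt 2" for \<omega>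
    by (simp_all add: contrast_p_def contrast_q_def)
  then have "(\<integral>\<^sup>+\<omega>. g (contrast_p (\<lambda>i. X i \<omega>) / \<sigma>) (contrast_q (\<lambda>i. X i \<omega>) / \<sigma>) \<partial>M)
    = (\<integral>\<^sup>+\<omega>. g ((2 * Z 3 \<omega> - Z 1 \<omega> - Z 2 \<omega>) / sqrt 6) ((Z 2 \<omega> - Z 1 \<omega>) / sqrt 2) \<partial>M)"
    by simp
  also have "\<dots> = (\<integral>\<^sup>+z. \<integral>\<^sup>+x. \<integral>\<^sup>+y. g ((2 * z - x - y) / sqrt 6) ((y - x) / sqrt 2) \<partial>std_gauss \<partial>std_gauss \<partial>std_gauss)"
    by (rule nn_integral_std_normal_triple[OF Zi Zd]) measurable
  also have "\<dots> = (\<integral>\<^sup>+p. \<integral>\<^sup>+q. g p q \<partial>std_gauss \<partial>std_gauss)"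
    by (rule nn_integral_std_gauss_contrasts[OF g])
  finally show ?thesis .
qed

lemma AE_nonzero_of_std_gauss:
  fixes P Q :: "'a \<Rightarrow> real"
  assumes [measurable]: "Q \<in> borel_measurable M"
    and law: "\<And>g. case_prod g \<in> borel_measurable (borel \<Otimes>\<^sub>M borel) \<Longrightarrow>
      (\<integral>\<^sup>+\<omega>. g (P \<omega>) (Q \<omega>) \<partial>M) = (\<integral>\<^sup>+p. \<integral>\<^sup>+q. g p q \<partial>std_gauss \<partial>std_gauss)"
  shows "AE \<omega> in M. Q \<omega> \<noteq> 0"
proof -
  have "(\<integral>\<^sup>+\<omega>. indicator {0} (Q \<omega>) \<partial>M) = (\<integral>\<^sup>+(p :: real). \<integral>\<^sup>+(q :: real). indicator {0} q \<partial>std_gauss \<partial>std_gauss)"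
    by (rule law) measurable
  also have "(\<integral>\<^sup>+(q :: real). indicator {0} q \<partial>std_gauss) = 0"
    using AE_lborel_singleton[of 0]
    by (subst nn_integral_0_iff_AE) (auto simp: AE_density elim!: eventually_mono)
  finally have "(\<integral>\<^sup>+\<omega>. indicator {0} (Q \<omega>) \<partial>M) = 0" by simp
  then show ?thesis
    by (subst (asm) nn_integral_0_iff_AE) (auto simp: indicator_eq_0_iff)
qed

section \<open>The polar angle of a planar Gaussian vector is uniform\<close>

lemma nn_integral_rayleigh:
  fixes k :: real
  assumes k: "k > 0"
  shows "(\<integral>\<^sup>+q. ennreal (q * exp (- k * q\<^sup>2)) * indicator {0..} q \<partial>lborel) = ennreal (1 / (2 * k))"
proof -
  have "((\<lambda>q. - exp (- k * q\<^sup>2) / (2 * k)) \<longlongrightarrow> 0) at_top"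
    using k by real_asymp
  then show ?thesis
    using k by (subst nn_integral_FTC_atLeast[where F = "\<lambda>q. - exp (- k * q\<^sup>2) / (2 * k)" and T = 0])
      (auto intro!: derivative_eq_intros simp: field_simps)
qed

lemma nn_integral_cauchy_tail:
  "(\<integral>\<^sup>+t. ennreal (1 / (2 * pi * (1 + t\<^sup>2))) * indicator {s..} t \<partial>lborel)
    = ennreal (1 / 4 - arctan s / (2 * pi))"
proof -
  have "((\<lambda>t. arctan t / (2 * pi)) \<longlongrightarrow> (pi / 2) / (2 * pi)) at_top"
    by (intro tendsto_intros tendsto_arctan_at_top) simp
  moreover have "((\<lambda>t. arctan t / (2 * pi)) has_real_derivative 1 / (2 * pi * (1 + t\<^sup>2))) (at t)" for t
    using DERIV_cdivide[OF DERIV_arctan[of t], of "2 * pi"] by (simp add: field_simps)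
  ultimately show ?thesis
    by (subst nn_integral_FTC_atLeast[where F = "\<lambda>t. arctan t / (2 * pi)" and T = "1 / 4"])
      (auto simp: add_pos_nonneg)
qed

text \<open>The substitution \<open>p = q t\<close> parametrises the sector by the slope \<open>t\<close> and turns the joint density into
\<open>q exp (- q\<^sup>2 (1 + t\<^sup>2) / 2) / (2 \<pi>)\<close>; integrating \<open>q\<close> first leaves the density
\<open>1 / (2 \<pi> (1 + t\<^sup>2))\<close> on the slopes \<open>t \<ge> s\<close>.\<close>

lemma std_gauss_sector:
  "(\<integral>\<^sup>+p. \<integral>\<^sup>+q. indicator {(p, q). 0 < q \<and> s * q \<le> p} (p, q) \<partial>std_gauss \<partial>std_gauss)
    = ennreal (1 / 4 - arctan s / (2 * pi))" (is "?L = _")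
proof -
  define h :: "real \<Rightarrow> real \<Rightarrow> ennreal" where
    "h p q = ennreal (std_normal_density p * std_normal_density q) * indicator {(p, q). 0 < q \<and> s * q \<le> p} (p, q)" for p q
  have [measurable]: "case_prod h \<in> borel_measurable (borel \<Otimes>\<^sub>M borel)"
    unfolding h_def by measurable
  have "?L = (\<integral>\<^sup>+p. \<integral>\<^sup>+q. h p q \<partial>lborel \<partial>lborel)"
    unfolding h_def by (rule nn_integral_std_gauss2) measurable
  also have "\<dots> = (\<integral>\<^sup>+q. \<integral>\<^sup>+p. h p q \<partial>lborel \<partial>lborel)"
    by (rule lborel_pair.Fubini') measurable
  also have "\<dots> = (\<integral>\<^sup>+q. \<integral>\<^sup>+t. ennreal (q * exp (- ((1 + t\<^sup>2) / 2) * q\<^sup>2)) * indicator {0..} q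
      * (ennreal (1 / (2 * pi)) * indicator {s..} t) \<partial>lborel \<partial>lborel)"
  proof (rule nn_integral_cong)
    fix q :: real
    show "(\<integral>\<^sup>+p. h p q \<partial>lborel) = (\<integral>\<^sup>+t. ennreal (q * exp (- ((1 + t\<^sup>2) / 2) * q\<^sup>2)) * indicator {0..} q
      * (ennreal (1 / (2 * pi)) * indicator {s..} t) \<partial>lborel)"
    proof (cases "q > 0")
      case True
      have "(\<integral>\<^sup>+p. h p q \<partial>lborel) = ennreal q * (\<integral>\<^sup>+t. h (q * t) q \<partial>lborel)"
        using True by (subst nn_integral_real_affine[where c = q and t = 0]) auto
      also have "\<dots> = (\<integral>\<^sup>+t. ennreal q * h (q * t) q \<partial>lborel)"
        by (rule nn_integral_cmult[symmetric]) measurable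
      also have "\<dots> = (\<integral>\<^sup>+t. ennreal (q * exp (- ((1 + t\<^sup>2) / 2) * q\<^sup>2)) * indicator {0..} q
          * (ennreal (1 / (2 * pi)) * indicator {s..} t) \<partial>lborel)"
      proof (rule nn_integral_cong)
        fix t :: real
        have "std_normal_density (q * t) * std_normal_density q
            = 1 / (2 * pi) * exp (- ((1 + t\<^sup>2) / 2) * q\<^sup>2)"
          by (simp add: std_normal_density_def real_sqrt_mult exp_add[symmetric] field_simps)
        then have "q * (std_normal_density (q * t) * std_normal_density q)
            = q * exp (- ((1 + t\<^sup>2) / 2) * q\<^sup>2) * (1 / (2 * pi))"
          by simp
        then show "ennreal q * h (q * t) q = ennreal (q * exp (- ((1 + t\<^sup>2) / 2) * q\<^sup>2)) * indicator {0..} q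
          * (ennreal (1 / (2 * pi)) * indicator {s..} t)"
          using True by (auto simp: h_def indicator_def simp flip: ennreal_mult)
      qed
      finally show ?thesis .
    next
      case False
      then show ?thesis by (cases "q = 0") (simp_all add: h_def)
    qed
  qed
  also have "\<dots> = (\<integral>\<^sup>+t. \<integral>\<^sup>+q. ennreal (q * exp (- ((1 + t\<^sup>2) / 2) * q\<^sup>2)) * indicator {0..} q
      * (ennreal (1 / (2 * pi)) * indicator {s..} t) \<partial>lborel \<partial>lborel)"
    by (rule lborel_pair.Fubini') measurable
  also have "\<dots> = (\<integral>\<^sup>+t. ennreal (1 / (2 * pi * (1 + t\<^sup>2))) * indicator {s..} t \<partial>lborel)"
  proof (rule nn_integral_cong)
    fix t :: real
    have "0 < (1 + t\<^sup>2) / 2" by (simp add: add_pos_nonneg)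
    then show "(\<integral>\<^sup>+q. ennreal (q * exp (- ((1 + t\<^sup>2) / 2) * q\<^sup>2)) * indicator {0..} q
      * (ennreal (1 / (2 * pi)) * indicator {s..} t) \<partial>lborel) = ennreal (1 / (2 * pi * (1 + t\<^sup>2))) * indicator {s..} t"
      by (subst nn_integral_multc, measurable, subst nn_integral_rayleigh)
        (auto simp: indicator_def field_simps simp flip: ennreal_mult)
  qed
  also have "\<dots> = ennreal (1 / 4 - arctan s / (2 * pi))"
    by (rule nn_integral_cauchy_tail)
  finally show ?thesis .
qed

text \<open>The point reflection at the origin maps this sector to the one in the upper half-plane.\<close>

lemma std_gauss_sector_neg:
  "(\<integral>\<^sup>+p. \<integral>\<^sup>+q. indicator {(p, q). q < 0 \<and> p \<le> s * q} (p, q) \<partial>std_gauss \<partial>std_gauss)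
    = ennreal (1 / 4 - arctan s / (2 * pi))" (is "?L = _")
proof -
  interpret G: prob_space std_gauss by (rule prob_space_std_gauss)
  have "?L = (\<integral>\<^sup>+p. \<integral>\<^sup>+q. indicator {(p, q). 0 < q \<and> s * q \<le> p} (- p, q) \<partial>std_gauss \<partial>std_gauss)"
    by (subst nn_integral_std_gauss_minus[symmetric])
      (auto intro!: nn_integral_cong split: split_indicator)
  also have "\<dots> = (\<integral>\<^sup>+p. \<integral>\<^sup>+q. indicator {(p, q). 0 < q \<and> s * q \<le> p} (p, q) \<partial>std_gauss \<partial>std_gauss)"
    by (rule nn_integral_std_gauss_minus[where
      f = "\<lambda>p. \<integral>\<^sup>+q. indicator {(p, q). 0 < q \<and> s * q \<le> p} (p, q) \<partial>std_gauss"]) measurable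
  finally show ?thesis by (simp add: std_gauss_sector)
qed

text \<open>The polar angle of the point \<open>(p, q)\<close>, in \<open>(0, \<pi>)\<close> on the upper and in \<open>(\<pi>, 2 \<pi>)\<close> on the lower
half-plane.  Through \<open>arctan (p / q)\<close> each half-plane is one smooth branch, on which the angle is a
decreasing function of the slope \<open>p / q\<close>.  The axis \<open>q = 0\<close> is a null set; there the value is the
arbitrary \<open>3 \<pi> / 2\<close>.\<close>

definition plane_angle :: "real \<Rightarrow> real \<Rightarrow> real" where
  "plane_angle p q = (if 0 < q then pi / 2 - arctan (p / q) else 3 * pi / 2 - arctan (p / q))"

lemma plane_angle_bounds: "0 < plane_angle p q" "plane_angle p q < 2 * pi"
  using arctan_bounded[of "p / q"] pi_gt_zero by (auto simp: plane_angle_def)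

lemma plane_angle_scale: "c > 0 \<Longrightarrow> plane_angle (p / c) (q / c) = plane_angle p q"
  by (cases "q = 0") (simp_all add: plane_angle_def zero_less_divide_iff)

lemma cos_plane_angle:
  assumes "q \<noteq> 0"
  shows "cos (plane_angle p q) = p / sqrt (p\<^sup>2 + q\<^sup>2)"
proof -
  have "sqrt (1 + (p / q)\<^sup>2) = sqrt ((p\<^sup>2 + q\<^sup>2) / q\<^sup>2)"
    using assms by (simp add: power_divide add_divide_distrib add.commute)
  also have "\<dots> = sqrt (p\<^sup>2 + q\<^sup>2) / \<bar>q\<bar>" by (simp add: real_sqrt_divide)
  finally have "sin (arctan (p / q)) = p / q * \<bar>q\<bar> / sqrt (p\<^sup>2 + q\<^sup>2)"
    by (simp add: sin_arctan)
  moreover have c: "cos (pi / 2 - t) = sin t" for t :: real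
    by (simp add: cos_diff)
  moreover have "cos (3 * pi / 2 - t) = - sin t" for t
  proof -
    have "3 * pi / 2 - t = (pi / 2 - t) + pi" by simp
    then show ?thesis by (simp only: cos_periodic_pi c)
  qed
  ultimately show ?thesis
    using assms by (cases "q > 0") (simp_all add: plane_angle_def)
qed

lemma plane_angle_le_pi_iff: "plane_angle p q \<le> pi \<longleftrightarrow> 0 < q"
  using arctan_bounded[of "p / q"] by (auto simp: plane_angle_def)

text \<open>These are the two kinds of sector whose probabilities were computed above, up to the whole upper
half-plane in the second case.\<close>

lemma plane_angle_le_iff:
  assumes "q \<noteq> 0"
  shows "0 < t \<Longrightarrow> t < pi \<Longrightarrow> plane_angle p q \<le> t \<longleftrightarrow> 0 < q \<and> tan (pi / 2 - t) * q \<le> p"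
    and "pi < t \<Longrightarrow> t < 2 * pi \<Longrightarrow> plane_angle p q \<le> t \<longleftrightarrow> 0 < q \<or> (q < 0 \<and> p \<le> tan (3 * pi / 2 - t) * q)"
proof -
  note b = arctan_bounded[of "p / q"]
  show "plane_angle p q \<le> t \<longleftrightarrow> 0 < q \<and> tan (pi / 2 - t) * q \<le> p" if t: "0 < t" "t < pi"
  proof (cases "q > 0")
    case True
    have "arctan (tan (pi / 2 - t)) = pi / 2 - t" by (rule arctan_tan) (use t in auto)
    then have "pi / 2 - t \<le> arctan (p / q) \<longleftrightarrow> tan (pi / 2 - t) \<le> p / q"
      by (metis arctan_le_iff)
    with True show ?thesis by (auto simp: plane_angle_def pos_le_divide_eq algebra_simps)
  next
    case False
    with t b show ?thesis by (auto simp: plane_angle_def)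
  qed
  show "plane_angle p q \<le> t \<longleftrightarrow> 0 < q \<or> (q < 0 \<and> p \<le> tan (3 * pi / 2 - t) * q)" if t: "pi < t" "t < 2 * pi"
  proof (cases "q > 0")
    case True
    with t b show ?thesis by (auto simp: plane_angle_def)
  next
    case False
    with assms have q: "q < 0" by simp
    have "arctan (tan (3 * pi / 2 - t)) = 3 * pi / 2 - t" by (rule arctan_tan) (use t in auto)
    then have "3 * pi / 2 - t \<le> arctan (p / q) \<longleftrightarrow> tan (3 * pi / 2 - t) \<le> p / q"
      by (metis arctan_le_iff)
    with q show ?thesis by (auto simp: plane_angle_def neg_le_divide_eq algebra_simps)
  qed
qed

lemma cdf_uniform_0_2pi:
  "cdf (uniform_measure lborel {0..<2 * pi}) t
    = (if t \<le> 0 then 0 else if t < 2 * pi then t / (2 * pi) else 1)"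
proof -
  have "{0..<2 * pi} \<inter> {..t} = (if t < 0 then {} else if t < 2 * pi then {0..t} else {0..<2 * pi})"
    by auto
  then show ?thesis
    by (auto simp: cdf_def2)
qed

text \<open>The distribution functions are compared.  Inside either half-plane the event \<open>\<theta> \<le> t\<close> is a sector with boundary
slope \<open>tan (\<pi> / 2 - t)\<close> or \<open>tan (3 \<pi> / 2 - t)\<close>, and the arctangent in its probability undoes the
tangent.  At \<open>t = \<pi>\<close> the slope would be infinite, so this value is handled separately.\<close>

lemma (in prob_space) plane_angle_uniform:
  fixes P Q :: "'a \<Rightarrow> real"
  assumes [measurable]: "P \<in> borel_measurable M" "Q \<in> borel_measurable M"
    and law: "\<And>g. case_prod g \<in> borel_measurable (borel \<Otimes>\<^sub>M borel) \<Longrightarrow>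
      (\<integral>\<^sup>+\<omega>. g (P \<omega>) (Q \<omega>) \<partial>M) = (\<integral>\<^sup>+p. \<integral>\<^sup>+q. g p q \<partial>std_gauss \<partial>std_gauss)"
    and nz: "AE \<omega> in M. Q \<omega> \<noteq> 0"
  defines "\<theta> \<equiv> \<lambda>\<omega>. plane_angle (P \<omega>) (Q \<omega>)"
  shows "\<theta> \<in> borel_measurable M" and "distr M borel \<theta> = uniform_measure lborel {0..<2 * pi}"
proof -
  show m[measurable]: "\<theta> \<in> borel_measurable M"
    unfolding \<theta>_def plane_angle_def by measurable
  have e: "emeasure M {\<omega>\<in>space M. (P \<omega>, Q \<omega>) \<in> A} = (\<integral>\<^sup>+p. \<integral>\<^sup>+q. indicator A (p, q) \<partial>std_gauss \<partial>std_gauss)"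
    if [measurable]: "A \<in> sets (borel \<Otimes>\<^sub>M borel)" for A
  proof -
    have "(\<integral>\<^sup>+p. \<integral>\<^sup>+q. indicator A (p, q) \<partial>std_gauss \<partial>std_gauss) = (\<integral>\<^sup>+\<omega>. indicator A (P \<omega>, Q \<omega>) \<partial>M)"
      by (rule law[symmetric]) simp
    also have "\<dots> = (\<integral>\<^sup>+\<omega>. indicator {\<omega>\<in>space M. (P \<omega>, Q \<omega>) \<in> A} \<omega> \<partial>M)"
      by (intro nn_integral_cong) (auto simp: indicator_def)
    finally show ?thesis by simp
  qed
  have upper: "prob {\<omega>\<in>space M. 0 < Q \<omega> \<and> s * Q \<omega> \<le> P \<omega>} = 1 / 4 - arctan s / (2 * pi)" for s
  proof -
    have "{x \<in> space (borel \<Otimes>\<^sub>M borel). 0 < snd x \<and> s * snd x \<le> fst x} \<in> sets (borel \<Otimes>\<^sub>M borel)"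
      by measurable
    then have "{(p, q). 0 < q \<and> s * q \<le> p} \<in> sets (borel \<Otimes>\<^sub>M borel)"
      by (simp add: space_pair_measure case_prod_beta')
    moreover have "0 \<le> 1 / 4 - arctan s / (2 * pi)"
      using arctan_ubound[of s] by (simp add: field_simps)
    ultimately show ?thesis
      using e[of "{(p, q). 0 < q \<and> s * q \<le> p}"] by (simp add: measure_def std_gauss_sector)
  qed
  have lower: "prob {\<omega>\<in>space M. Q \<omega> < 0 \<and> P \<omega> \<le> s * Q \<omega>} = 1 / 4 - arctan s / (2 * pi)" for s
  proof -
    have "{x \<in> space (borel \<Otimes>\<^sub>M borel). snd x < 0 \<and> fst x \<le> s * snd x} \<in> sets (borel \<Otimes>\<^sub>M borel)"
      by measurable
    then have "{(p, q). q < 0 \<and> p \<le> s * q} \<in> sets (borel \<Otimes>\<^sub>M borel)"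
      by (simp add: space_pair_measure case_prod_beta')
    moreover have "0 \<le> 1 / 4 - arctan s / (2 * pi)"
      using arctan_ubound[of s] by (simp add: field_simps)
    ultimately show ?thesis
      using e[of "{(p, q). q < 0 \<and> p \<le> s * q}"] by (simp add: measure_def std_gauss_sector_neg)
  qed
  have cdf: "cdf (distr M borel \<theta>) t = prob {\<omega>\<in>space M. \<theta> \<omega> \<le> t}" for t
    by (simp add: cdf_def2 measure_distr vimage_def Int_def conj_commute)
  \<comment> \<open>By the symmetry \<open>q \<mapsto> - q\<close> the two half-planes have equal probability.\<close>
  have half: "prob {\<omega>\<in>space M. 0 < Q \<omega>} = 1 / 2"
  proof -
    have "{x \<in> space (borel \<Otimes>\<^sub>M borel). 0 < snd x} \<in> sets (borel \<Otimes>\<^sub>M (borel :: real measure))"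
      "{x \<in> space (borel \<Otimes>\<^sub>M borel). snd x < 0} \<in> sets (borel \<Otimes>\<^sub>M (borel :: real measure))"
      by measurable
    then have S: "{(p :: real, q :: real). 0 < q} \<in> sets (borel \<Otimes>\<^sub>M borel)"
      "{(p :: real, q :: real). q < 0} \<in> sets (borel \<Otimes>\<^sub>M borel)"
      by (simp_all add: space_pair_measure case_prod_beta')
    have "(\<integral>\<^sup>+q. indicator {(p :: real, q). 0 < q} (p, q) \<partial>std_gauss)
        = (\<integral>\<^sup>+q. indicator {(p, q). q < 0} (p, q) \<partial>std_gauss)" for p
      using nn_integral_std_gauss_minus[of "indicator {0<..}"] by (simp add: indicator_def)
    then have "emeasure M {\<omega>\<in>space M. 0 < Q \<omega>} = emeasure M {\<omega>\<in>space M. Q \<omega> < 0}"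
      using e[OF S(1)] e[OF S(2)] by simp
    then have "prob {\<omega>\<in>space M. 0 < Q \<omega>} = prob {\<omega>\<in>space M. Q \<omega> < 0}"
      by (simp add: measure_def)
    moreover have "prob ({\<omega>\<in>space M. 0 < Q \<omega>} \<union> {\<omega>\<in>space M. Q \<omega> < 0}) = 1"
      by (subst prob_eq_1) (use nz in \<open>auto elim!: eventually_mono\<close>)
    moreover have "prob ({\<omega>\<in>space M. 0 < Q \<omega>} \<union> {\<omega>\<in>space M. Q \<omega> < 0})
      = prob {\<omega>\<in>space M. 0 < Q \<omega>} + prob {\<omega>\<in>space M. Q \<omega> < 0}"
      by (rule finite_measure_Union) auto
    ultimately show ?thesis by simp
  qed
  have open_cdf: "cdf (distr M borel \<theta>) t = t / (2 * pi)" if t: "0 < t" "t < pi" for t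
  proof -
    have "cdf (distr M borel \<theta>) t = prob {\<omega>\<in>space M. 0 < Q \<omega> \<and> tan (pi / 2 - t) * Q \<omega> \<le> P \<omega>}"
      unfolding cdf
    proof (rule finite_measure_eq_AE)
      show "AE \<omega> in M. \<omega> \<in> {\<omega>\<in>space M. \<theta> \<omega> \<le> t}
          \<longleftrightarrow> \<omega> \<in> {\<omega>\<in>space M. 0 < Q \<omega> \<and> tan (pi / 2 - t) * Q \<omega> \<le> P \<omega>}"
        using nz by eventually_elim (use t in \<open>simp add: \<theta>_def plane_angle_le_iff\<close>)
    qed measurable
    also have "\<dots> = 1 / 4 - (pi / 2 - t) / (2 * pi)"
    proof -
      have "arctan (tan (pi / 2 - t)) = pi / 2 - t" by (rule arctan_tan) (use t in auto)
      then show ?thesis by (simp only: upper)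
    qed
    also have "\<dots> = t / (2 * pi)" by (simp add: field_simps)
    finally show ?thesis .
  qed
  have open_cdf': "cdf (distr M borel \<theta>) t = t / (2 * pi)" if t: "pi < t" "t < 2 * pi" for t
  proof -
    let ?s = "tan (3 * pi / 2 - t)"
    have "cdf (distr M borel \<theta>) t = prob ({\<omega>\<in>space M. 0 < Q \<omega>} \<union> {\<omega>\<in>space M. Q \<omega> < 0 \<and> P \<omega> \<le> ?s * Q \<omega>})"
      unfolding cdf
    proof (rule finite_measure_eq_AE)
      show "AE \<omega> in M. \<omega> \<in> {\<omega>\<in>space M. \<theta> \<omega> \<le> t}
          \<longleftrightarrow> \<omega> \<in> {\<omega>\<in>space M. 0 < Q \<omega>} \<union> {\<omega>\<in>space M. Q \<omega> < 0 \<and> P \<omega> \<le> ?s * Q \<omega>}"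
        using nz by eventually_elim (use t in \<open>auto simp: \<theta>_def plane_angle_le_iff\<close>)
    qed measurable
    also have "\<dots> = prob {\<omega>\<in>space M. 0 < Q \<omega>} + prob {\<omega>\<in>space M. Q \<omega> < 0 \<and> P \<omega> \<le> ?s * Q \<omega>}"
      by (rule finite_measure_Union) auto
    also have "\<dots> = 1 / 2 + (1 / 4 - (3 * pi / 2 - t) / (2 * pi))"
    proof -
      have "arctan ?s = 3 * pi / 2 - t" by (rule arctan_tan) (use t in auto)
      then show ?thesis by (simp only: half lower)
    qed
    also have "\<dots> = t / (2 * pi)" by (simp add: field_simps)
    finally show ?thesis .
  qed
  interpret D: real_distribution "distr M borel \<theta>"
    by (rule real_distribution_distr) measurable
  have U: "real_distribution (uniform_measure lborel {0..<2 * pi})"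
    unfolding real_distribution_def real_distribution_axioms_def
    by (auto intro!: prob_space_uniform_measure)
  have bounds: "0 < \<theta> \<omega>" "\<theta> \<omega> < 2 * pi" for \<omega>
    by (simp_all add: \<theta>_def plane_angle_bounds)
  show "distr M borel \<theta> = uniform_measure lborel {0..<2 * pi}"
  proof (rule cdf_unique[OF D.real_distribution_axioms U], rule ext)
    fix t :: real
    consider "t \<le> 0" | "0 < t" "t < pi" | "t = pi" | "pi < t" "t < 2 * pi" | "2 * pi \<le> t"
      by linarith
    then show "cdf (distr M borel \<theta>) t = cdf (uniform_measure lborel {0..<2 * pi}) t"
    proof cases
      case 1
      then have "{\<omega>\<in>space M. \<theta> \<omega> \<le> t} = {}"
        using bounds(1) by (force simp: not_le intro: le_less_trans)
      with 1 show ?thesis by (simp only: cdf cdf_uniform_0_2pi) simp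
    next
      case 3
      have "{\<omega>\<in>space M. \<theta> \<omega> \<le> pi} = {\<omega>\<in>space M. 0 < Q \<omega>}"
        unfolding \<theta>_def by (simp only: plane_angle_le_pi_iff)
      with 3 show ?thesis by (simp add: cdf cdf_uniform_0_2pi half not_le)
    next
      case 5
      then have "{\<omega>\<in>space M. \<theta> \<omega> \<le> t} = space M"
        using bounds(2) by (force intro: less_imp_le less_le_trans)
      moreover have "\<not> t \<le> 0" using 5 pi_gt_zero by linarith
      ultimately show ?thesis using 5 by (simp add: cdf cdf_uniform_0_2pi prob_space)
    qed (simp_all add: open_cdf open_cdf' cdf_uniform_0_2pi)
  qed
qed

section \<open>Skewness and kurtosis of three points\<close>

lemma sqrt6: "sqrt 6 = sqrt 2 * sqrt 3" by (simp flip: real_sqrt_mult)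

lemma sum_1_to_3: "(\<Sum>i=1..3. f i) = f 1 + f 2 + f (3::nat)" for f :: "nat \<Rightarrow> real"
proof -
  have "{1..3} = {1, 2, 3::nat}" by auto
  then show ?thesis by simp
qed

lemma deviations:
  defines "d \<equiv> \<lambda>x i. x i - sample_mean 3 x"
  shows "d x 3 = 2 / sqrt 6 * contrast_p x"
    and "d x 1 = - (contrast_p x / sqrt 6 + contrast_q x / sqrt 2)"
    and "d x 2 = - (contrast_p x / sqrt 6 - contrast_q x / sqrt 2)"
  unfolding d_def sample_mean_def contrast_p_def contrast_q_def sum_1_to_3
  by (simp_all add: field_simps)

text \<open>With \<open>a = p / \<surd>6\<close> and \<open>b = q / \<surd>2\<close> the three deviations from the mean are \<open>- (a + b)\<close>,
\<open>- (a - b)\<close> and \<open>2 a\<close>, so that only the squares of \<open>p\<close> and \<open>q\<close> and one factor \<open>\<surd>6\<close> survive.\<close>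

lemma central_moments_contrasts:
  fixes x :: "nat \<Rightarrow> real"
  defines "p \<equiv> contrast_p x" and "q \<equiv> contrast_q x"
  shows "central_moment 3 2 x = (p\<^sup>2 + q\<^sup>2) / 3"
    and "central_moment 3 3 x = (p ^ 3 - 3 * p * q\<^sup>2) / (3 * sqrt 6)"
    and "central_moment 3 4 x = (p\<^sup>2 + q\<^sup>2)\<^sup>2 / 6"
proof -
  define a b where "a = p / sqrt 6" and "b = q / sqrt 2"
  have d: "x 3 - sample_mean 3 x = 2 * a" "x 1 - sample_mean 3 x = - (a + b)"
    "x 2 - sample_mean 3 x = - (a - b)"
    using deviations[of x] by (simp_all add: a_def b_def p_def q_def)
  have pq: "p = sqrt 6 * a" "q = sqrt 2 * b" by (simp_all add: a_def b_def)
  have e: "p\<^sup>2 = 6 * a\<^sup>2" "q\<^sup>2 = 2 * b\<^sup>2" by (simp_all add: pq power_mult_distrib)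
  have m: "central_moment 3 r x = ((- (a + b)) ^ r + (- (a - b)) ^ r + (2 * a) ^ r) / 3" for r
    unfolding central_moment_def sum_1_to_3 d by simp
  show "central_moment 3 2 x = (p\<^sup>2 + q\<^sup>2) / 3"
    unfolding m e by (simp add: power2_eq_square algebra_simps)
  have "p ^ 3 - 3 * p * q\<^sup>2 = sqrt 6 * a * (p\<^sup>2 - 3 * q\<^sup>2)"
    by (simp add: pq(1) power3_eq_cube power2_eq_square algebra_simps)
  also have "\<dots> = sqrt 6 * (6 * a ^ 3 - 6 * a * b\<^sup>2)"
    unfolding e by (simp add: power3_eq_cube power2_eq_square algebra_simps)
  finally have "(p ^ 3 - 3 * p * q\<^sup>2) / (3 * sqrt 6) = 2 * a ^ 3 - 2 * a * b\<^sup>2"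
    by simp
  moreover have "central_moment 3 3 x = 2 * a ^ 3 - 2 * a * b\<^sup>2"
    unfolding m by (simp add: power3_eq_cube power2_eq_square field_simps)
  ultimately show "central_moment 3 3 x = (p ^ 3 - 3 * p * q\<^sup>2) / (3 * sqrt 6)"
    by simp
  show "central_moment 3 4 x = (p\<^sup>2 + q\<^sup>2)\<^sup>2 / 6"
    unfolding m e by (simp add: power4_eq_xxxx power2_eq_square algebra_simps)
qed

lemma sample_kurtosis_3:
  assumes "contrast_q x \<noteq> 0"
  shows "sample_kurtosis 3 x = 3 / 2"
proof -
  have "(contrast_p x)\<^sup>2 + (contrast_q x)\<^sup>2 > 0" using assms by (simp add: add_nonneg_pos)
  then show ?thesis
    using assms by (simp add: sample_kurtosis_def central_moments_contrasts power_divide)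
qed

text \<open>Since \<open>q\<^sup>2 = r\<^sup>2 - p\<^sup>2\<close>, the cubic \<open>p\<^sup>3 - 3 p q\<^sup>2\<close> equals \<open>4 p\<^sup>3 - 3 p r\<^sup>2\<close>, which is the triple-angle
polynomial in \<open>c = p / r\<close> up to the factor \<open>r\<^sup>3\<close>.\<close>

lemma sample_skewness_3:
  fixes x :: "nat \<Rightarrow> real"
  defines "c \<equiv> contrast_p x / sqrt ((contrast_p x)\<^sup>2 + (contrast_q x)\<^sup>2)"
  assumes "contrast_q x \<noteq> 0"
  shows "sample_skewness 3 x = (4 * c ^ 3 - 3 * c) / sqrt 2"
proof -
  define p q where "p = contrast_p x" and "q = contrast_q x"
  define r where "r = sqrt (p\<^sup>2 + q\<^sup>2)"
  have "p\<^sup>2 + q\<^sup>2 > 0" using assms by (simp add: add_nonneg_pos q_def)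
  then have r: "r > 0" "r\<^sup>2 = p\<^sup>2 + q\<^sup>2" by (simp_all add: r_def)
  have "((p\<^sup>2 + q\<^sup>2) / 3) powr (3 / 2) = ((r / sqrt 3)\<^sup>2) powr (3 / 2)"
    by (simp add: r power_divide)
  also have "\<dots> = (r / sqrt 3) powr 3"
    using r(1) by (simp add: powr_powr flip: powr_numeral)
  also have "\<dots> = r ^ 3 / (3 * sqrt 3)"
    using r(1) by (simp add: power_divide power3_eq_cube)
  finally have m2: "((p\<^sup>2 + q\<^sup>2) / 3) powr (3 / 2) = r ^ 3 / (3 * sqrt 3)" .
  have c: "c = p / r" by (simp add: c_def p_def q_def r_def)
  have "4 * c ^ 3 - 3 * c = (4 * p ^ 3 - 3 * p * r\<^sup>2) / r ^ 3"
    using r(1) by (simp add: c power_divide field_simps power3_eq_cube power2_eq_square)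
  also have "4 * p ^ 3 - 3 * p * r\<^sup>2 = p ^ 3 - 3 * p * q\<^sup>2"
    unfolding r(2) by (simp add: power3_eq_cube power2_eq_square algebra_simps)
  finally have "4 * c ^ 3 - 3 * c = (p ^ 3 - 3 * p * q\<^sup>2) / r ^ 3" .
  moreover have "sample_skewness 3 x = (p ^ 3 - 3 * p * q\<^sup>2) / (3 * sqrt 6) / (r ^ 3 / (3 * sqrt 3))"
    unfolding sample_skewness_def central_moments_contrasts p_def[symmetric] q_def[symmetric] m2 ..
  ultimately show ?thesis
    by (simp add: sqrt6)
qed

lemma jarque_bera_3:
  assumes "contrast_q x \<noteq> 0"
  defines "t \<equiv> plane_angle (contrast_p x) (contrast_q x)"
  shows "sample_skewness 3 x = cos (3 * t) / sqrt 2"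
    and "jarque_bera 3 x = 9 / 32 + (cos (3 * t))\<^sup>2 / 4"
proof -
  show S: "sample_skewness 3 x = cos (3 * t) / sqrt 2"
    using sample_skewness_3[OF assms(1)] cos_plane_angle[OF assms(1), of "contrast_p x"]
    by (simp add: t_def cos_treble_cos)
  show "jarque_bera 3 x = 9 / 32 + (cos (3 * t))\<^sup>2 / 4"
    unfolding jarque_bera_def S sample_kurtosis_3[OF assms(1)]
    by (simp add: power_divide power2_eq_square field_simps)
qed

section \<open>The arcsine law\<close>

lemma arcsin_sqrt:
  assumes "0 \<le> y" "y \<le> 1"
  shows "0 \<le> arcsin (sqrt y)" "arcsin (sqrt y) \<le> pi / 2" "sin (arcsin (sqrt y)) = sqrt y"
    and "y < 1 \<Longrightarrow> arcsin (sqrt y) < pi / 2"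
proof -
  have "- 1 \<le> sqrt y" using assms real_sqrt_ge_zero[of y] by linarith
  then show "0 \<le> arcsin (sqrt y)" "arcsin (sqrt y) \<le> pi / 2" "sin (arcsin (sqrt y)) = sqrt y"
    "y < 1 \<Longrightarrow> arcsin (sqrt y) < pi / 2"
    using assms arcsin_bounded[of "sqrt y"] arcsin_le_arcsin[of 0 "sqrt y"] arcsin_less_arcsin[of "sqrt y" 1]
    by auto
qed

text \<open>The distribution function of the Beta law with both parameters \<open>1 / 2\<close>; that it is so is
\<open>cdf_arcsine_law\<close> below.\<close>

definition arcsine_cdf :: "real \<Rightarrow> real" where
  "arcsine_cdf y = (if y \<le> 0 then 0 else if y < 1 then 2 / pi * arcsin (sqrt y) else 1)"

lemma arcsine_cdf_unit: "0 \<le> y \<Longrightarrow> y \<le> 1 \<Longrightarrow> arcsine_cdf y = 2 / pi * arcsin (sqrt y)"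
  by (cases "y = 1") (auto simp: arcsine_cdf_def)

lemma arcsine_cdf_nonneg: "0 \<le> arcsine_cdf y"
  using arcsin_sqrt(1)[of y] by (simp add: arcsine_cdf_def)

lemma arcsine_cdf_strict_mono:
  assumes "0 \<le> x" "x < y" "y \<le> 1"
  shows "arcsine_cdf x < arcsine_cdf y"
proof -
  have "- 1 \<le> sqrt x" using assms real_sqrt_ge_zero[of x] by linarith
  then have "arcsin (sqrt x) < arcsin (sqrt y)"
    using assms by (intro arcsin_less_arcsin) auto
  then show ?thesis using assms by (simp add: arcsine_cdf_unit divide_strict_right_mono)
qed

lemma arcsine_cdf_sin:
  assumes "0 < p" "p < 1"
  shows "arcsine_cdf ((sin (pi * p / 2))\<^sup>2) = p"
proof -
  have b: "0 < pi * p / 2" "pi * p / 2 < pi / 2" using assms by auto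
  then have "0 < sin (pi * p / 2)" by (intro sin_gt_zero) auto
  then have "sqrt ((sin (pi * p / 2))\<^sup>2) = sin (pi * p / 2)" by simp
  moreover have "arcsin (sin (pi * p / 2)) = pi * p / 2"
    by (rule arcsin_sin) (use b pi_gt_zero in linarith)+
  ultimately show ?thesis
    by (simp add: arcsine_cdf_unit power_le_one abs_square_le_1 field_simps)
qed

text \<open>A Galois connection: \<open>arcsine_cdf\<close> is strictly increasing on \<open>[0, 1]\<close> and takes the
value \<open>p\<close> at \<open>sin\<^sup>2 (\<pi> p / 2)\<close>.\<close>

lemma arcsine_cdf_quantile:
  assumes p: "0 < p" "p < 1"
  shows "p \<le> arcsine_cdf y \<longleftrightarrow> (sin (pi * p / 2))\<^sup>2 \<le> y"
proof -
  let ?y = "(sin (pi * p / 2))\<^sup>2"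
  have y: "0 \<le> ?y" "?y \<le> 1" by (simp_all add: abs_square_le_1)
  have F: "arcsine_cdf ?y = p" by (rule arcsine_cdf_sin[OF p])
  consider "y < 0" | "0 \<le> y" "y < ?y" | "y = ?y" | "?y < y" "y \<le> 1" | "1 < y" by linarith
  then show ?thesis
  proof cases
    case 1
    then have "\<not> ?y \<le> y" "arcsine_cdf y = 0" using y by (linarith, simp add: arcsine_cdf_def)
    with p show ?thesis by simp
  next
    case 2 with arcsine_cdf_strict_mono[of y ?y] y F show ?thesis by simp
  next
    case 3 with F show ?thesis by simp
  next
    case 4 with arcsine_cdf_strict_mono[of ?y y] y F show ?thesis by simp
  next
    case 5
    then have "?y \<le> y" "arcsine_cdf y = 1" using y by (linarith, simp add: arcsine_cdf_def)
    with p show ?thesis by simp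
  qed
qed

lemma nn_integral_periodic:
  fixes h :: "real \<Rightarrow> ennreal"
  assumes [measurable]: "h \<in> borel_measurable borel" and per: "\<And>x. h (x + c) = h x" and c: "0 \<le> c"
  shows "(\<integral>\<^sup>+x. h x * indicator {0..<real n * c} x \<partial>lborel)
    = of_nat n * (\<integral>\<^sup>+x. h x * indicator {0..<c} x \<partial>lborel)"
proof (induction n)
  case (Suc n)
  have per': "h (real n * c + x) = h x" for n x
  proof (induction n)
    case (Suc n)
    then show ?case using per[of "real n * c + x"] by (simp add: algebra_simps)
  qed simp
  define a where "a = real n * c"
  have a: "0 \<le> a" "real (Suc n) * c = a + c" using c by (simp_all add: a_def algebra_simps)
  have "(\<integral>\<^sup>+x. h x * indicator {0..<real (Suc n) * c} x \<partial>lborel)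
      = (\<integral>\<^sup>+x. h x * indicator {0..<a} x + h x * indicator {a..<a + c} x \<partial>lborel)"
    unfolding a(2) using a(1) c by (intro nn_integral_cong) (auto split: split_indicator)
  also have "\<dots> = of_nat n * (\<integral>\<^sup>+x. h x * indicator {0..<c} x \<partial>lborel)
      + (\<integral>\<^sup>+x. h x * indicator {a..<a + c} x \<partial>lborel)"
    by (subst nn_integral_add) (simp_all add: Suc a_def)
  also have "(\<integral>\<^sup>+x. h x * indicator {a..<a + c} x \<partial>lborel)
      = (\<integral>\<^sup>+x. h x * indicator {0..<c} x \<partial>lborel)"
    by (subst nn_integral_real_affine[where c = 1 and t = a])
      (auto simp: per' a_def intro!: nn_integral_cong split: split_indicator)
  finally show ?case by (simp add: algebra_simps)
qed simp

lemma cos_squared_le_iff: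
  assumes "0 \<le> y" "y \<le> 1" "0 \<le> u" "u \<le> pi"
  shows "(cos u)\<^sup>2 \<le> y \<longleftrightarrow> u \<in> {pi / 2 - arcsin (sqrt y)..pi / 2 + arcsin (sqrt y)}"
proof -
  define a where "a = arcsin (sqrt y)"
  have a: "0 \<le> a" "a \<le> pi / 2" "sin a = sqrt y"
    using arcsin_sqrt[OF assms(1,2)] by (simp_all add: a_def)
  have "(cos u)\<^sup>2 \<le> y \<longleftrightarrow> \<bar>cos u\<bar> \<le> sqrt y"
    by (metis assms(1) real_sqrt_abs real_sqrt_le_iff)
  also have "\<dots> \<longleftrightarrow> cos u \<le> cos (pi / 2 - a) \<and> cos (pi / 2 + a) \<le> cos u"
    using a by (auto simp: cos_diff cos_add abs_le_iff)
  also have "\<dots> \<longleftrightarrow> pi / 2 - a \<le> u \<and> u \<le> pi / 2 + a"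
    using a assms by (subst (1 2) cos_mono_le_eq) auto
  finally show ?thesis by (simp add: a_def)
qed

lemma emeasure_cos_squared:
  assumes "0 \<le> y" "y < 1"
  shows "emeasure lborel {u \<in> {0..<pi}. (cos u)\<^sup>2 \<le> y} = ennreal (2 * arcsin (sqrt y))"
proof -
  let ?a = "arcsin (sqrt y)"
  have a: "?a < pi / 2" using arcsin_sqrt(4)[of y] assms by simp
  have "u \<in> {0..<pi} \<and> (cos u)\<^sup>2 \<le> y \<longleftrightarrow> u \<in> {pi / 2 - ?a..pi / 2 + ?a}" for u
  proof (cases "u \<in> {0..<pi}")
    case True
    then show ?thesis using cos_squared_le_iff[of y u] assms by simp
  next
    case False
    then show ?thesis using a by auto
  qed
  then have "{u \<in> {0..<pi}. (cos u)\<^sup>2 \<le> y} = {pi / 2 - ?a..pi / 2 + ?a}"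
    by blast
  moreover have "0 \<le> ?a" using arcsin_sqrt(1)[of y] assms by simp
  ultimately show ?thesis by simp
qed

text \<open>The substitution \<open>u = 3 t\<close> stretches \<open>[0, 2 \<pi>)\<close> to \<open>[0, 6 \<pi>)\<close>, six periods of \<open>cos\<^sup>2\<close>; the net factor is
\<open>6 / 3 = 2\<close>.\<close>

lemma emeasure_cos_squared_3:
  assumes "0 \<le> y" "y < 1"
  shows "emeasure lborel {t \<in> {0..<2 * pi}. (cos (3 * t))\<^sup>2 \<le> y} = ennreal (4 * arcsin (sqrt y))"
proof -
  define h :: "real \<Rightarrow> ennreal" where "h u = indicator {u. (cos u)\<^sup>2 \<le> y} u" for u
  have [measurable]: "h \<in> borel_measurable borel" unfolding h_def by measurable
  have "emeasure lborel {t \<in> {0..<2 * pi}. (cos (3 * t))\<^sup>2 \<le> y}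
      = (\<integral>\<^sup>+t. indicator {t \<in> {0..<2 * pi}. (cos (3 * t))\<^sup>2 \<le> y} t \<partial>lborel)"
    by (rule nn_integral_indicator[symmetric]) measurable
  also have "\<dots> = (\<integral>\<^sup>+t. h (3 * t) * indicator {0..<2 * pi} t \<partial>lborel)"
    by (intro nn_integral_cong) (auto simp: h_def split: split_indicator)
  also have "\<dots> = ennreal (1 / 3) * (\<integral>\<^sup>+u. h u * indicator {0..<real 6 * pi} u \<partial>lborel)"
    by (subst nn_integral_real_affine[where c = "1 / 3" and t = 0])
      (auto intro!: arg_cong2[where f = times] nn_integral_cong split: split_indicator)
  also have "\<dots> = ennreal (1 / 3) * (6 * (\<integral>\<^sup>+u. h u * indicator {0..<pi} u \<partial>lborel))"
    by (subst nn_integral_periodic) (auto simp: h_def split: split_indicator)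
  also have "(\<integral>\<^sup>+u. h u * indicator {0..<pi} u \<partial>lborel)
      = (\<integral>\<^sup>+u. indicator {u \<in> {0..<pi}. (cos u)\<^sup>2 \<le> y} u \<partial>lborel)"
    by (intro nn_integral_cong) (auto simp: h_def split: split_indicator)
  also have "\<dots> = ennreal (2 * arcsin (sqrt y))"
    unfolding emeasure_cos_squared[OF assms, symmetric] by (rule nn_integral_indicator) measurable
  also have "ennreal (1 / 3) * (6 * ennreal (2 * arcsin (sqrt y))) = ennreal (4 * arcsin (sqrt y))"
  proof -
    have "0 \<le> arcsin (sqrt y)" using arcsin_sqrt(1)[of y] assms by simp
    then show ?thesis by (simp flip: ennreal_mult ennreal_numeral)
  qed
  finally show ?thesis .
qed

lemma cdf_cos_squared_3:
  "measure (uniform_measure lborel {0..<2 * pi}) {t. (cos (3 * t))\<^sup>2 \<le> y} = arcsine_cdf y"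
proof -
  consider "y < 0" | "0 \<le> y" "y < 1" | "1 \<le> y" by linarith
  then show ?thesis
  proof cases
    case 1
    then have "{t. (cos (3 * t))\<^sup>2 \<le> y} = {}" by (auto simp: not_le intro: less_le_trans)
    with 1 show ?thesis by (simp add: arcsine_cdf_def)
  next
    case 2
    have "{0..<2 * pi} \<inter> {t. (cos (3 * t))\<^sup>2 \<le> y} = {t \<in> {0..<2 * pi}. (cos (3 * t))\<^sup>2 \<le> y}"
      by auto
    moreover have "0 \<le> arcsin (sqrt y)" using arcsin_sqrt(1)[of y] 2 by simp
    ultimately show ?thesis
      using emeasure_cos_squared_3[OF 2] 2
      by (simp add: measure_uniform_measure measure_def arcsine_cdf_unit divide_ennreal)
  next
    case 3
    have "(cos (3 * t))\<^sup>2 \<le> y" for t :: real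
      using 3 abs_cos_le_one[of "3 * t"] by (metis abs_square_le_1 order_trans)
    then have "{t. (cos (3 * t))\<^sup>2 \<le> y} = UNIV" by auto
    with 3 show ?thesis by (simp add: arcsine_cdf_def measure_def)
  qed
qed

lemma Beta_half_half: "Beta (1 / 2) (1 / 2 :: real) = pi"
  by (simp add: Beta_def Gamma_one_half_real)

lemma beta_density_half_nonneg: "0 \<le> beta_density (1 / 2) (1 / 2) y"
  by (simp add: beta_density_def Beta_half_half)

lemma beta_density_measurable [measurable]: "beta_density a b \<in> borel_measurable borel"
  unfolding beta_density_def by measurable

text \<open>The function \<open>(2 / \<pi>) arcsin (\<surd>x)\<close> is a primitive of the density only on the open unit interval: near
its end points the density is unbounded.  The fundamental theorem is therefore used on \<open>(0, y)\<close>, with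
the boundary values of the primitive as one-sided limits.\<close>

lemma emeasure_beta_half:
  assumes y: "0 < y" "y \<le> 1"
  shows "(\<integral>\<^sup>+x. ennreal (beta_density (1 / 2) (1 / 2) x) * indicator {..y} x \<partial>lborel)
    = ennreal (2 / pi * arcsin (sqrt y))"
proof -
  let ?f = "beta_density (1 / 2) (1 / 2)" and ?F = "\<lambda>x. 2 / pi * arcsin (sqrt x)"
  have f: "?f x = 1 / (pi * (sqrt x * sqrt (1 - x)))" if "0 < x" "x < 1" for x
    using that by (simp add: beta_density_def Beta_half_half powr_minus powr_half_sqrt field_simps)
  note nonneg = beta_density_half_nonneg
  have d: "(?F has_real_derivative ?f x) (at x)" if "0 < x" "x < 1" for x
  proof -
    have "- 1 < sqrt x" using that real_sqrt_gt_zero[of x] by linarith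
    with that show ?thesis by (auto intro!: derivative_eq_intros simp: f field_simps)
  qed
  have c: "isCont ?f x" if "0 < x" "x < 1" for x
  proof -
    have "\<forall>\<^sub>F z in nhds x. ?f z = 1 / (pi * (sqrt z * sqrt (1 - z)))"
      using eventually_nhds_in_open[of "{0<..<1}" x] that by (auto elim!: eventually_mono simp: f)
    then have "isCont ?f x \<longleftrightarrow> isCont (\<lambda>z. 1 / (pi * (sqrt z * sqrt (1 - z)))) x"
      by (rule isCont_cong)
    also have "\<dots>" using that by (auto intro!: continuous_intros)
    finally show ?thesis .
  qed
  have cont: "continuous_on {0..y} ?F"
  proof (intro continuous_intros ballI conjI)
    fix x assume "x \<in> {0..y}"
    then show "- 1 \<le> sqrt x" "sqrt x \<le> 1" using y by (auto intro: order_trans[of "- 1" 0])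
  qed
  have A: "((?F \<circ> real_of_ereal) \<longlongrightarrow> 0) (at_right (ereal 0))"
    using continuous_on_Icc_at_rightD[OF cont y(1)] by (simp add: ereal_tendsto_simps1)
  have B: "((?F \<circ> real_of_ereal) \<longlongrightarrow> ?F y) (at_left (ereal y))"
    using continuous_on_Icc_at_leftD[OF cont y(1)] by (simp add: ereal_tendsto_simps1)
  have *: "set_integrable lborel (einterval (ereal 0) (ereal y)) ?f"
    "(LBINT x=ereal 0..ereal y. ?f x) = ?F y - 0"
    using y by (intro interval_integral_FTC_nonneg[OF _ _ _ _ A B] d c; auto simp: nonneg)+
  have "(\<integral>\<^sup>+x. ennreal (?f x) * indicator {..y} x \<partial>lborel)
      = (\<integral>\<^sup>+x. ennreal (indicator {0<..<y} x *\<^sub>R ?f x) \<partial>lborel)"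
    using AE_lborel_singleton[of y]
    by (intro nn_integral_cong_AE) (auto simp: beta_density_def indicator_def elim!: eventually_mono)
  also have "\<dots> = ennreal (LBINT x=ereal 0..ereal y. ?f x)"
    using *(1) y unfolding interval_lebesgue_integral_def set_lebesgue_integral_def set_integrable_def
    by (subst nn_integral_eq_integral) (auto simp: nonneg)
  finally show ?thesis using * by simp
qed

abbreviation arcsine_law :: "real measure" where
  "arcsine_law \<equiv> density lborel (\<lambda>y. ennreal (beta_density (1 / 2) (1 / 2) y))"

lemma emeasure_arcsine_law: "emeasure arcsine_law {..y} = ennreal (arcsine_cdf y)"
proof -
  have e: "emeasure arcsine_law {..y} = (\<integral>\<^sup>+x. ennreal (beta_density (1 / 2) (1 / 2) x) * indicator {..y} x \<partial>lborel)"
    by (rule emeasure_density) measurable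
  consider "y \<le> 0" | "0 < y" "y \<le> 1" | "1 < y" by linarith
  then show ?thesis
  proof cases
    case 1
    then have "emeasure arcsine_law {..y} = (\<integral>\<^sup>+(x :: real). 0 \<partial>lborel)"
      unfolding e by (intro nn_integral_cong) (auto simp: beta_density_def indicator_def)
    with 1 show ?thesis by (simp add: arcsine_cdf_def)
  next
    case 2
    then show ?thesis
      unfolding e by (simp add: emeasure_beta_half arcsine_cdf_unit)
  next
    case 3
    then have "emeasure arcsine_law {..y} = (\<integral>\<^sup>+x. ennreal (beta_density (1 / 2) (1 / 2) x) * indicator {..1} x \<partial>lborel)"
      unfolding e by (intro nn_integral_cong) (auto simp: beta_density_def indicator_def)
    with 3 show ?thesis by (simp add: emeasure_beta_half arcsine_cdf_def)
  qed
qed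

lemma cdf_arcsine_law: "cdf arcsine_law y = arcsine_cdf y"
  by (simp add: cdf_def2 measure_def emeasure_arcsine_law arcsine_cdf_nonneg)

lemma real_distribution_arcsine_law: "real_distribution arcsine_law"
proof -
  have "emeasure arcsine_law UNIV = emeasure arcsine_law {..1}"
    by (subst (1 2) emeasure_density, measurable, intro nn_integral_cong)
      (auto simp: beta_density_def indicator_def)
  then have "emeasure arcsine_law UNIV = 1"
    by (simp add: emeasure_arcsine_law arcsine_cdf_def)
  then show ?thesis
    unfolding real_distribution_def real_distribution_axioms_def by (auto intro: prob_spaceI)
qed

lemma (in prob_space) cos_squared_3_arcsine_law:
  fixes \<theta> :: "'a \<Rightarrow> real"
  assumes [measurable]: "\<theta> \<in> borel_measurable M"
    and u: "distr M borel \<theta> = uniform_measure lborel {0..<2 * pi}"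
    and [measurable]: "Y \<in> borel_measurable M"
    and Y: "AE \<omega> in M. Y \<omega> = (cos (3 * \<theta> \<omega>))\<^sup>2"
  shows "distributed M lborel Y (\<lambda>y. ennreal (beta_density (1 / 2) (1 / 2) y))"
proof -
  have "cdf (distr M borel Y) y = cdf arcsine_law y" for y
  proof -
    have "cdf (distr M borel Y) y = prob {\<omega>\<in>space M. Y \<omega> \<le> y}"
      by (simp add: cdf_def2 measure_distr vimage_def Int_def conj_commute)
    also have "\<dots> = prob {\<omega>\<in>space M. (cos (3 * \<theta> \<omega>))\<^sup>2 \<le> y}"
      by (rule finite_measure_eq_AE) (use Y in \<open>auto elim!: eventually_mono\<close>)
    also have "\<dots> = measure (distr M borel \<theta>) {t. (cos (3 * t))\<^sup>2 \<le> y}"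
      by (subst measure_distr) (auto simp: vimage_def Int_def conj_commute)
    finally show ?thesis by (simp add: u cdf_cos_squared_3 cdf_arcsine_law)
  qed
  then have "distr M borel Y = arcsine_law"
    by (intro cdf_unique real_distribution_arcsine_law real_distribution_distr) auto
  then show ?thesis
    unfolding distributed_def by (simp cong: distr_cong)
qed

section \<open>The Jarque--Bera statistic of three normal observations\<close>

text \<open>Every neighbourhood of a point of \<open>[l, h]\<close> contains a half-open interval inside \<open>[l, h]\<close>, which is
charged because the distribution function increases strictly; the complement of \<open>[l, h]\<close> is
open and carries no mass.\<close>

lemma measure_support_eq_Icc:
  fixes N :: "real measure"
  assumes "real_distribution N" "l < h" and lo: "cdf N l = 0" and hi: "cdf N h = 1"
    and strict: "\<And>x y. l \<le> x \<Longrightarrow> x < y \<Longrightarrow> y \<le> h \<Longrightarrow> cdf N x < cdf N y"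
  shows "measure_support N = {l..h}"
proof -
  interpret N: real_distribution N by fact
  have "x \<in> measure_support N" if "x \<in> {l..h}" for x
    unfolding measure_support_def
  proof safe
    have x: "l \<le> x" "x \<le> h" using that by auto
    fix U :: "real set" assume U: "open U" "x \<in> U"
    then obtain e where e: "e > 0" "ball x e \<subseteq> U" by (meson open_contains_ball)
    define a b where "a = max l (x - e / 2)" and "b = min h (x + e / 2)"
    have ab: "l \<le> a" "a < b" "b \<le> h" using e x \<open>l < h\<close> by (auto simp: a_def b_def)
    have "{a<..b} \<subseteq> ball x e" using e by (auto simp: a_def b_def dist_real_def)
    then have "{a<..b} \<subseteq> U" using e by blast
    then have "measure N {a<..b} \<le> measure N U"
      using U by (intro N.finite_measure_mono) auto
    moreover have "measure N {a<..b} = cdf N b - cdf N a"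
      using N.cdf_diff_eq[OF ab(2)] by simp
    ultimately have "0 < measure N U" using strict[OF ab] by simp
    then show "0 < emeasure N U" by (simp add: N.emeasure_eq_measure)
  qed
  moreover have "x \<in> {l..h}" if "x \<in> measure_support N" for x
  proof (rule ccontr)
    assume x: "x \<notin> {l..h}"
    have "measure N {l<..h} = 1" using N.cdf_diff_eq[OF \<open>l < h\<close>] lo hi by simp
    then have "measure N {l..h} = 1"
      using N.finite_measure_mono[of "{l<..h}" "{l..h}"] N.prob_le_1[of "{l..h}"] by force
    then have "measure N (- {l..h}) = 0"
      using N.prob_compl[of "{l..h}"] by (simp add: Compl_eq_Diff_UNIV)
    moreover have "open (- {l..h})" by auto
    ultimately show False
      using that x unfolding measure_support_def by (auto simp: N.emeasure_eq_measure)
  qed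
  ultimately show ?thesis by (intro subset_antisym subsetI)
qed

theorem proposition3:
  fixes M :: "'a measure" and X :: "nat \<Rightarrow> 'a \<Rightarrow> real" and \<mu> \<sigma> :: real
    and S K JB :: "'a \<Rightarrow> real"
  assumes "prob_space M"
    and "\<sigma> > 0"
    and "prob_space.indep_vars M (\<lambda>_. borel) X {1..3}"
    and "\<And>i. i \<in> {1..3} \<Longrightarrow> distributed M lborel (X i) (\<lambda>x. ennreal (normal_density \<mu> \<sigma> x))"
  defines "S \<equiv> \<lambda>\<omega>. sample_skewness 3 (\<lambda>i. X i \<omega>)"
    and "K \<equiv> \<lambda>\<omega>. sample_kurtosis 3 (\<lambda>i. X i \<omega>)"
    and "JB \<equiv> \<lambda>\<omega>. jarque_bera 3 (\<lambda>i. X i \<omega>)"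
  shows "(AE \<omega> in M. K \<omega> = 3 / 2)
    \<and> (\<exists>\<theta> \<in> borel_measurable M.
          distr M borel \<theta> = uniform_measure lborel {0..<2 * pi}
          \<and> (AE \<omega> in M. S \<omega> = cos (3 * \<theta> \<omega>) / sqrt 2))
    \<and> (\<exists>Y. distributed M lborel Y (\<lambda>y. ennreal (beta_density (1 / 2) (1 / 2) y))
          \<and> (AE \<omega> in M. JB \<omega> = 9 / 32 + Y \<omega> / 4))
    \<and> measure_support (distr M borel JB) = {9 / 32..17 / 32}
    \<and> (\<forall>x \<in> {9 / 32..17 / 32}.
          cdf (distr M borel JB) x = 2 / pi * arcsin (sqrt (4 * (x - 9 / 32))))
    \<and> distributed M lborel JB
        (\<lambda>x. ennreal (4 / pi * ((4 * x - 9 / 8) * (17 / 8 - 4 * x)) powr (- 1 / 2)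
                      * indicator {9 / 32..17 / 32} x))
    \<and> (\<forall>p \<in> {0<..<1}.
          quantile (distr M borel JB) p = 9 / 32 + (sin (pi * p / 2))\<^sup>2 / 4)"
proof -
  interpret prob_space M by fact
  define P Q where "P = (\<lambda>\<omega>. contrast_p (\<lambda>i. X i \<omega>))" and "Q = (\<lambda>\<omega>. contrast_q (\<lambda>i. X i \<omega>))"
  define \<theta> where "\<theta> = (\<lambda>\<omega>. plane_angle (P \<omega>) (Q \<omega>))"
  \<comment> \<open>Taking the affine image of the statistic itself, rather than \<open>cos\<^sup>2 (3 \<theta>)\<close>, makes the relation
    between \<open>Y\<close> and \<open>JB\<close> exact and not only almost sure.\<close>
  define Y where "Y = (\<lambda>\<omega>. 4 * (JB \<omega> - 9 / 32))"
  have [measurable]: "X i \<in> borel_measurable M" if "i \<in> {1..3}" for i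
    using distributed_measurable[OF assms(4)[OF that]] by simp
  then have [measurable]: "X (Suc 0) \<in> borel_measurable M" "X 2 \<in> borel_measurable M" "X 3 \<in> borel_measurable M"
    by simp_all
  have [measurable]: "P \<in> borel_measurable M" "Q \<in> borel_measurable M"
    unfolding P_def Q_def contrast_p_def contrast_q_def by simp_all
  have [measurable]: "JB \<in> borel_measurable M"
    unfolding JB_def jarque_bera_def sample_skewness_def sample_kurtosis_def central_moments_contrasts
    using \<open>P \<in> borel_measurable M\<close> \<open>Q \<in> borel_measurable M\<close>
    unfolding P_def Q_def by measurable
  have [measurable]: "Y \<in> borel_measurable M" unfolding Y_def by measurable
  have law: "(\<integral>\<^sup>+\<omega>. g (P \<omega> / \<sigma>) (Q \<omega> / \<sigma>) \<partial>M) = (\<integral>\<^sup>+p. \<integral>\<^sup>+q. g p q \<partial>std_gauss \<partial>std_gauss)"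
    if "case_prod g \<in> borel_measurable (borel \<Otimes>\<^sub>M borel)" for g
    unfolding P_def Q_def by (rule contrasts_std_gauss[OF assms(2-4) that])
  have PQ: "(\<lambda>\<omega>. P \<omega> / \<sigma>) \<in> borel_measurable M" "(\<lambda>\<omega>. Q \<omega> / \<sigma>) \<in> borel_measurable M"
    by measurable
  have Q\<sigma>: "AE \<omega> in M. Q \<omega> / \<sigma> \<noteq> 0"
    by (rule AE_nonzero_of_std_gauss[OF PQ(2) law])
  then have Q: "AE \<omega> in M. Q \<omega> \<noteq> 0" by eventually_elim simp
  have \<theta>': "\<theta> = (\<lambda>\<omega>. plane_angle (P \<omega> / \<sigma>) (Q \<omega> / \<sigma>))"
    using assms(2) by (simp add: \<theta>_def plane_angle_scale)
  have \<theta>: "\<theta> \<in> borel_measurable M" "distr M borel \<theta> = uniform_measure lborel {0..<2 * pi}"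
    unfolding \<theta>' using plane_angle_uniform[OF PQ law Q\<sigma>] by simp_all
  have S: "AE \<omega> in M. S \<omega> = cos (3 * \<theta> \<omega>) / sqrt 2"
    and JB: "AE \<omega> in M. JB \<omega> = 9 / 32 + (cos (3 * \<theta> \<omega>))\<^sup>2 / 4"
    and K: "AE \<omega> in M. K \<omega> = 3 / 2"
    using Q by (eventually_elim, simp add: S_def JB_def K_def \<theta>_def P_def Q_def jarque_bera_3 sample_kurtosis_3)+
  have "AE \<omega> in M. Y \<omega> = (cos (3 * \<theta> \<omega>))\<^sup>2"
    using JB by eventually_elim (simp add: Y_def)
  then have Y: "distributed M lborel Y (\<lambda>y. ennreal (beta_density (1 / 2) (1 / 2) y))"
    by (intro cos_squared_3_arcsine_law[OF \<theta>]) measurable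
  have JBY: "JB \<omega> = 9 / 32 + Y \<omega> / 4" for \<omega> by (simp add: Y_def field_simps)
  have "distr M borel Y = arcsine_law"
    using distributed_distr_eq_density[OF Y] by (simp cong: distr_cong)
  then have cdf: "cdf (distr M borel JB) x = arcsine_cdf (4 * (x - 9 / 32))" for x
  proof -
    have "cdf (distr M borel JB) x = cdf (distr M borel Y) (4 * (x - 9 / 32))"
      unfolding cdf_def2
      by (subst (1 2) measure_distr) (auto simp: JBY intro!: arg_cong[where f = prob])
    then show ?thesis
      by (simp add: \<open>distr M borel Y = arcsine_law\<close> cdf_arcsine_law)
  qed
  have supp: "measure_support (distr M borel JB) = {9 / 32..17 / 32}"
    by (rule measure_support_eq_Icc)
      (auto simp: cdf arcsine_cdf_def[of 0] arcsine_cdf_def[of 1] intro!: arcsine_cdf_strict_mono)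
  have cdf_in: "cdf (distr M borel JB) x = 2 / pi * arcsin (sqrt (4 * (x - 9 / 32)))"
    if "x \<in> {9 / 32..17 / 32}" for x
    unfolding cdf by (rule arcsine_cdf_unit) (use that in auto)
  \<comment> \<open>At the end points the Beta density is \<open>0\<close> by definition, and the right-hand side is \<open>0\<close>
    because \<open>0 powr (- 1 / 2) = 0\<close>.\<close>
  have dens: "ennreal (beta_density (1 / 2) (1 / 2) ((x - 9 / 32) / (1 / 4))) / ennreal \<bar>1 / 4\<bar>
      = ennreal (4 / pi * ((4 * x - 9 / 8) * (17 / 8 - 4 * x)) powr (- 1 / 2) * indicator {9 / 32..17 / 32} x)" for x
  proof -
    have scale: "ennreal b / ennreal \<bar>1 / 4\<bar> = ennreal (4 * b)" if "0 \<le> b" for b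
      using that by (subst divide_ennreal) auto
    have arg: "(x - 9 / 32) / (1 / 4) = 4 * x - 9 / 8" by simp
    have "4 * beta_density (1 / 2) (1 / 2) (4 * x - 9 / 8)
        = 4 / pi * ((4 * x - 9 / 8) * (17 / 8 - 4 * x)) powr (- 1 / 2) * indicator {9 / 32..17 / 32} x"
    proof (cases "9 / 32 < x \<and> x < 17 / 32")
      case True
      then show ?thesis
        by (simp add: beta_density_def Beta_half_half powr_mult)
    next
      case False
      then consider "x < 9 / 32" | "x = 9 / 32" | "x = 17 / 32" | "17 / 32 < x" by linarith
      then show ?thesis by cases (auto simp: beta_density_def)
    qed
    then show ?thesis
      unfolding arg scale[OF beta_density_half_nonneg] by (rule arg_cong)
  qed
  have "distributed M lborel JB (\<lambda>x. ennreal (4 / pi * ((4 * x - 9 / 8) * (17 / 8 - 4 * x)) powr (- 1 / 2)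
      * indicator {9 / 32..17 / 32} x))"
    using distributed_affine[OF Y, of "1 / 4" "9 / 32"] unfolding dens by (simp add: JBY[abs_def])
  moreover have "quantile (distr M borel JB) p = 9 / 32 + (sin (pi * p / 2))\<^sup>2 / 4" if "p \<in> {0<..<1}" for p
  proof -
    have "{x. p \<le> cdf (distr M borel JB) x} = {9 / 32 + (sin (pi * p / 2))\<^sup>2 / 4..}"
      using that by (auto simp: cdf arcsine_cdf_quantile)
    then show ?thesis by (simp add: quantile_def)
  qed
  ultimately show ?thesis
    using K \<theta> S Y JBY supp cdf_in by blast
qed

end
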